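(* Let $G\in\mathcal{G}$ be an infinite graph. Then all positive harmonic functions on $G$ are constant.
   Context: All graphs are undirected, connected, locally finite and simple, $G=(V,E)$, with combinatorial distance $d$. $\deg(u)$ is the number of neighbors of $u$; $\mathrm{diam}(G)=\sup\{d(u,v):u,v\in V\}\in[0,\infty]$. Graphs are combinatorial: all edge and vertex weights equal $1$. The Laplacian is $\Delta f(u)=\sum_{v\sim u}(f(v)-f(u))$ for $f:V\to\mathbb{R}$, and $f$ is harmonic if $\Delta f\equiv0$. Curvature. For small $\varepsilon>0$ let $\mu_u^\varepsilon$ be the probability measure with $\mu_u^\varepsilon(u)=1-\varepsilon\deg(u)$, $\mu_u^\varepsilon(v)=\varepsilon$ if $v\sim u$, and $0$ otherwise. The Wasserstein distance is $W(\mu,\nu)=\inf_A\sum_{u,v\in V}A(u,v)d(u,v)$, the infimum over all couplings $A:V\times V\to[0,1]$ with $\sum_v A(u,v)=\mu(u)$ and $\sum_u A(u,v)=\nu(v)$. Put $\kappa_\varepsilon(u,v)=1-W(\mu_u^\varepsilon,\mu_v^\varepsilon)/d(u,v)$; the Lin-Lu-Yau-Ollivier Ricci curvature is $\kappa(u,v)=\lim_{\varepsilon\to0^+}\frac1\varepsilon\kappa_\varepsilon(u,v)$ (the limit exists). $\mathcal{G}$ is the class of such graphs $G$ with $\deg(u)\le 3$ for all $u\in V$, $\kappa(u,v)\ge 0$ for every edge $uv\in E$, and $\mathrm{diam}(G)\ge 6$. *)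

theory Defs
  imports "HOL-Analysis.Analysis"
begin

text \<open>
  An undirected simple graph is given by its vertex set \<open>V\<close> and its adjacency relation \<open>E\<close>,
  a symmetric irreflexive relation on \<open>V\<close>; the edge \<open>uv\<close> corresponds to the two pairs
  \<open>(u, v)\<close> and \<open>(v, u)\<close>. Functions \<open>V \<rightarrow> \<real>\<close> are functions on the whole type of which
  only the values on \<open>V\<close> matter.
\<close>

definition locally_finite_connected_graph :: "'a set \<Rightarrow> 'a rel \<Rightarrow> bool" where
  "locally_finite_connected_graph V E \<longleftrightarrow>
     E \<subseteq> V \<times> V \<and> sym E \<and> irrefl E \<and>
     (\<forall>u\<in>V. finite (E `` {u})) \<and>
     V \<noteq> {} \<and> (\<forall>u\<in>V. \<forall>v\<in>V. (u, v) \<in> E\<^sup>*)"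

definition degree :: "'a rel \<Rightarrow> 'a \<Rightarrow> nat" where
  "degree E u = card (E `` {u})"

text \<open>Length of a shortest walk; only meaningful when a walk from \<open>u\<close> to \<open>v\<close> exists.\<close>

definition gdist :: "'a rel \<Rightarrow> 'a \<Rightarrow> 'a \<Rightarrow> nat" where
  "gdist E u v = (LEAST n. (u, v) \<in> E ^^ n)"

definition gdiam :: "'a set \<Rightarrow> 'a rel \<Rightarrow> enat" where
  "gdiam V E = (SUP u\<in>V. SUP v\<in>V. enat (gdist E u v))"

definition laplacian :: "'a rel \<Rightarrow> ('a \<Rightarrow> real) \<Rightarrow> 'a \<Rightarrow> real" where
  "laplacian E f u = (\<Sum>v\<in>E `` {u}. f v - f u)"

definition harmonic :: "'a set \<Rightarrow> 'a rel \<Rightarrow> ('a \<Rightarrow> real) \<Rightarrow> bool" where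
  "harmonic V E f \<longleftrightarrow> (\<forall>u\<in>V. laplacian E f u = 0)"

definition walk_measure :: "'a rel \<Rightarrow> real \<Rightarrow> 'a \<Rightarrow> 'a \<Rightarrow> real" where
  "walk_measure E \<epsilon> u x =
     (if x = u then 1 - \<epsilon> * real (degree E u) else if (u, x) \<in> E then \<epsilon> else 0)"

definition couplings :: "'a set \<Rightarrow> ('a \<Rightarrow> real) \<Rightarrow> ('a \<Rightarrow> real) \<Rightarrow> ('a \<Rightarrow> 'a \<Rightarrow> real) set" where
  "couplings V \<mu> \<nu> =
     {A. (\<forall>u\<in>V. \<forall>v\<in>V. A u v \<in> {0..1}) \<and>
         (\<forall>u\<in>V. ((\<lambda>v. A u v) has_sum \<mu> u) V) \<and>
         (\<forall>v\<in>V. ((\<lambda>u. A u v) has_sum \<nu> v) V)}"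

text \<open>
  The measures used below are finitely supported, so every coupling vanishes outside a finite
  subset of \<open>V \<times> V\<close> and the infinite sum always converges. For small \<open>\<epsilon>\<close> the set of couplings
  is nonempty, since it contains the product coupling.
\<close>

definition wasserstein :: "'a set \<Rightarrow> 'a rel \<Rightarrow> ('a \<Rightarrow> real) \<Rightarrow> ('a \<Rightarrow> real) \<Rightarrow> real" where
  "wasserstein V E \<mu> \<nu> =
     (INF A\<in>couplings V \<mu> \<nu>. \<Sum>\<^sub>\<infinity>(u, v)\<in>V \<times> V. A u v * real (gdist E u v))"

definition curvature_eps :: "'a set \<Rightarrow> 'a rel \<Rightarrow> real \<Rightarrow> 'a \<Rightarrow> 'a \<Rightarrow> real" where
  "curvature_eps V E \<epsilon> u v =
     1 - wasserstein V E (walk_measure E \<epsilon> u) (walk_measure E \<epsilon> v) / real (gdist E u v)"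

text \<open>Lin--Lu--Yau--Ollivier Ricci curvature.\<close>

definition curvature :: "'a set \<Rightarrow> 'a rel \<Rightarrow> 'a \<Rightarrow> 'a \<Rightarrow> real" where
  "curvature V E u v = Lim (at_right 0) (\<lambda>\<epsilon>. 1 / \<epsilon> * curvature_eps V E \<epsilon> u v)"

definition class_G :: "'a set \<Rightarrow> 'a rel \<Rightarrow> bool" where
  "class_G V E \<longleftrightarrow>
     locally_finite_connected_graph V E \<and>
     (\<forall>u\<in>V. degree E u \<le> 3) \<and>
     (\<forall>(u, v)\<in>E. curvature V E u v \<ge> 0) \<and>
     gdiam V E \<ge> 6"

end

theory Submission
  imports Defs
begin

text \<open>
  Nonnegative curvature enters through weak Kantorovich duality only: a 1-Lipschitz function that
  increases by 1 along an edge has a Laplacian that does not increase along that edge. Applied to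
  functions built from distances this restricts the neighbours off a geodesic so much that,
  away from the end points, every vertex at distance 2 from a vertex of the geodesic
  is within distance 1 of the geodesic. Hence two geodesics from the same root that pass through
  the same vertex at distance 5 stay close, spheres have bounded size and balls grow linearly.
  Cutting off at scale \<open>n\<close> then costs energy \<open>O(1/n)\<close>, and testing the equation with
  \<open>\<eta>\<^sup>2 / f\<close> (Picone's identity) shows that \<open>f\<close> is constant along every edge.
\<close>

section \<open>Distances and geodesics\<close>

locale lfc_graph =
  fixes V :: "'a set" and E :: "'a rel"
  assumes lfc: "locally_finite_connected_graph V E"
begin

abbreviation d :: "'a \<Rightarrow> 'a \<Rightarrow> nat" where "d \<equiv> gdist E"

lemma edge_V: "(u, v) \<in> E \<Longrightarrow> u \<in> V \<and> v \<in> V"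
  using lfc by (auto simp: locally_finite_connected_graph_def)

lemma edge_sym: "(u, v) \<in> E \<Longrightarrow> (v, u) \<in> E"
  using lfc by (auto simp: locally_finite_connected_graph_def dest: symD)

lemma edge_neq: "(u, v) \<in> E \<Longrightarrow> u \<noteq> v"
  using lfc by (auto simp: locally_finite_connected_graph_def irrefl_def)

lemma finite_nbrs: "finite (E `` {u})"
proof (cases "u \<in> V")
  case True
  then show ?thesis using lfc by (auto simp: locally_finite_connected_graph_def)
next
  case False
  then have "E `` {u} = {}" using edge_V by blast
  then show ?thesis by simp
qed

lemma relpow_gdist: "u \<in> V \<Longrightarrow> v \<in> V \<Longrightarrow> (u, v) \<in> E ^^ d u v"
  using lfc unfolding gdist_def locally_finite_connected_graph_def
  by (meson LeastI rtrancl_imp_relpow)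

lemma gdist_le: "(u, v) \<in> E ^^ n \<Longrightarrow> d u v \<le> n"
  unfolding gdist_def by (rule Least_le)

lemma gdist_self [simp]: "d u u = 0"
  using gdist_le[of u u 0] by simp

lemma gdist_eq_0: "u \<in> V \<Longrightarrow> v \<in> V \<Longrightarrow> d u v = 0 \<longleftrightarrow> u = v"
  using relpow_gdist[of u v] by auto

lemma gdist_triangle:
  assumes "u \<in> V" "v \<in> V" "w \<in> V"
  shows "d u w \<le> d u v + d v w"
proof (rule gdist_le)
  show "(u, w) \<in> E ^^ (d u v + d v w)"
    unfolding relpow_add using relpow_gdist assms by blast
qed

lemma relpow_sym: "(u, v) \<in> E ^^ n \<Longrightarrow> (v, u) \<in> E ^^ n"
proof (induction n arbitrary: v)
  case (Suc n)
  then obtain w where "(u, w) \<in> E ^^ n" "(w, v) \<in> E" by auto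
  then show ?case using Suc.IH edge_sym by (meson relpow_Suc_I2)
qed simp

lemma gdist_sym: "u \<in> V \<Longrightarrow> v \<in> V \<Longrightarrow> d u v = d v u"
  using relpow_gdist relpow_sym gdist_le by (meson le_antisym)

lemma gdist_eq_1: "u \<in> V \<Longrightarrow> v \<in> V \<Longrightarrow> d u v = 1 \<longleftrightarrow> (u, v) \<in> E"
proof
  assume "u \<in> V" "v \<in> V" "d u v = 1"
  then show "(u, v) \<in> E" using relpow_gdist[of u v] by simp
next
  assume "u \<in> V" "v \<in> V" "(u, v) \<in> E"
  then have "d u v \<le> 1" "d u v \<noteq> 0" using gdist_le[of u v 1] gdist_eq_0 edge_neq by auto
  then show "d u v = 1" by simp
qed

lemma gdist_edge: "(u, v) \<in> E \<Longrightarrow> d u v = 1"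
  using gdist_eq_1 edge_V by blast

lemma gdist_le_1: "u \<in> V \<Longrightarrow> v \<in> V \<Longrightarrow> d u v \<le> 1 \<longleftrightarrow> u = v \<or> (u, v) \<in> E"
  using gdist_eq_0[of u v] gdist_eq_1[of u v] by linarith

lemma gdist_split:
  assumes "u \<in> V" "v \<in> V" "k \<le> d u v"
  obtains w where "w \<in> V" "d u w = k" "d w v = d u v - k"
proof -
  have "(u, v) \<in> E ^^ (k + (d u v - k))" using relpow_gdist assms by simp
  then obtain w where w: "(u, w) \<in> E ^^ k" "(w, v) \<in> E ^^ (d u v - k)"
    unfolding relpow_add by blast
  have "w \<in> V"
    using w(1) assms(1) edge_V by (cases k) auto
  moreover have "d u w \<le> k" "d w v \<le> d u v - k" using w gdist_le by auto
  moreover have "d u v \<le> d u w + d w v" using gdist_triangle assms \<open>w \<in> V\<close> by blast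
  ultimately show ?thesis using that assms(3) by force
qed

lemma gdist_2_common_nbr:
  assumes "u \<in> V" "v \<in> V" "d u v = 2"
  obtains w where "(u, w) \<in> E" "(w, v) \<in> E"
proof -
  obtain w where "w \<in> V" "d u w = 1" "d w v = 1"
    using gdist_split[of u v 1] assms by auto
  then show ?thesis using that gdist_eq_1 assms by blast
qed

text \<open>A shortcut between \<open>p i\<close> and \<open>p j\<close> would also shorten the walk
  from \<open>p 0\<close> to \<open>p n\<close>, so minimality of the total length passes to every
  piece.\<close>

lemma geodesic_dist:
  assumes path: "\<And>i. i < n \<Longrightarrow> (p i, p (Suc i)) \<in> E"
    and V0: "p 0 \<in> V" and len: "d (p 0) (p n) = n" and "i \<le> j" "j \<le> n"
  shows "p i \<in> V" "d (p i) (p j) = j - i"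
proof -
  have pV: "p k \<in> V" if "k \<le> n" for k
    using that V0 edge_V[OF path] by (cases k) (auto simp: Suc_le_eq)
  have up: "d (p k) (p l) \<le> l - k" if "k \<le> l" "l \<le> n" for k l
    using that
  proof (induction l rule: dec_induct)
    case (step m)
    have "d (p k) (p (Suc m)) \<le> d (p k) (p m) + d (p m) (p (Suc m))"
      using step by (intro gdist_triangle pV) auto
    then show ?case using step gdist_edge[OF path, of m] by simp
  qed simp
  show "p i \<in> V" using pV assms by simp
  have "d (p 0) (p n) \<le> d (p 0) (p i) + d (p i) (p n)"
    using assms by (intro gdist_triangle pV) auto
  moreover have "d (p i) (p n) \<le> d (p i) (p j) + d (p j) (p n)"
    using assms by (intro gdist_triangle pV) auto
  ultimately show "d (p i) (p j) = j - i"
    using up[of 0 i] up[of i j] up[of j n] assms by simp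
qed

text \<open>Summing over the closed neighbourhood only adds a zero term at \<open>u\<close>. One
  formula thus covers degree 3 and, with \<open>x = u\<close>, degree 2.\<close>

lemma laplacian_off:
  assumes "x \<noteq> a" "x \<noteq> b" "a \<noteq> b" "insert u (E `` {u}) = {u, a, b, x}" "(u, a) \<in> E" "(u, b) \<in> E"
  shows "laplacian E f u = f a + f b + f x - 3 * f u"
proof -
  have "laplacian E f u = (\<Sum>v\<in>insert u (E `` {u}). f v - f u)"
    unfolding laplacian_def by (rule sum.mono_neutral_left) (auto simp: finite_nbrs)
  also have "\<dots> = f a + f b + f x - 3 * f u"
    unfolding assms(4) using assms(1-3) edge_neq[OF assms(5)] edge_neq[OF assms(6)]
    by (cases "x = u") (auto simp: insert_commute)
  finally show ?thesis .
qed

section \<open>Curvature and Laplacian comparison\<close>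

abbreviation star :: "'a \<Rightarrow> 'a set" where "star u \<equiv> insert u (E `` {u})"

lemma star_subset: "u \<in> V \<Longrightarrow> star u \<subseteq> V"
  using edge_V by blast

lemma finite_star: "finite (star u)"
  using finite_nbrs by simp

lemma walk_measure_outside: "x \<notin> star u \<Longrightarrow> walk_measure E \<epsilon> u x = 0"
  by (simp add: walk_measure_def)

lemma sum_walk_measure:
  "(\<Sum>x\<in>star u. g x * walk_measure E \<epsilon> u x) = g u + \<epsilon> * laplacian E g u"
proof -
  have u: "u \<notin> E `` {u}" using edge_neq by blast
  have "(\<Sum>x\<in>E `` {u}. g x * walk_measure E \<epsilon> u x) = (\<Sum>x\<in>E `` {u}. \<epsilon> * g x)"
    using u by (intro sum.cong) (auto simp: walk_measure_def)
  also have "\<dots> = \<epsilon> * (\<Sum>x\<in>E `` {u}. g x)"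
    by (simp add: sum_distrib_left)
  also have "(\<Sum>x\<in>E `` {u}. g x) = laplacian E g u + real (degree E u) * g u"
    unfolding laplacian_def degree_def by (simp add: sum_subtractf)
  finally show ?thesis
    using u finite_nbrs[of u] by (simp add: walk_measure_def[of E \<epsilon> u u] algebra_simps)
qed

lemma has_sum_walk_measure:
  assumes "u \<in> V"
  shows "(walk_measure E \<epsilon> u has_sum 1) V"
proof (rule has_sum_finite_neutralI)
  show "1 = sum (walk_measure E \<epsilon> u) (star u)"
    using sum_walk_measure[of "\<lambda>_. 1" \<epsilon> u] by (simp add: laplacian_def)
qed (use finite_star star_subset[OF assms] walk_measure_outside in auto)

section \<open>Couplings of two walk measures\<close>

context
  fixes u v \<epsilon> A
  assumes uv: "u \<in> V" "v \<in> V"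
    and A: "A \<in> couplings V (walk_measure E \<epsilon> u) (walk_measure E \<epsilon> v)"
begin

lemma coupling_nonneg: "x \<in> V \<Longrightarrow> y \<in> V \<Longrightarrow> 0 \<le> A x y"
  using A by (auto simp: couplings_def)

text \<open>Nonnegative entries in a row or column of total mass 0 must vanish. This reduces all
  sums over \<open>V\<close> to finite ones.\<close>

lemma coupling_outside:
  assumes "x \<in> V" "y \<in> V" "x \<notin> star u \<or> y \<notin> star v"
  shows "A x y = 0"
proof -
  have 1: "((\<lambda>y. A x y) has_sum walk_measure E \<epsilon> u x) V"
    and 2: "((\<lambda>x. A x y) has_sum walk_measure E \<epsilon> v y) V"
    using A assms by (auto simp: couplings_def)
  show ?thesis
    using nonneg_has_sum_le_0D[OF 1] nonneg_has_sum_le_0D[OF 2] coupling_nonneg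
      walk_measure_outside assms by auto
qed

lemma coupling_cost:
  "(\<Sum>\<^sub>\<infinity>(x, y)\<in>V \<times> V. A x y * c x y) = (\<Sum>x\<in>star u. \<Sum>y\<in>star v. A x y * c x y)"
proof -
  have "(\<Sum>\<^sub>\<infinity>(x, y)\<in>V \<times> V. A x y * c x y) = (\<Sum>\<^sub>\<infinity>(x, y)\<in>star u \<times> star v. A x y * c x y)"
  proof (rule infsum_cong_neutral)
    fix z assume "z \<in> V \<times> V - star u \<times> star v"
    then show "(case z of (x, y) \<Rightarrow> A x y * c x y) = 0"
      using coupling_outside[of "fst z" "snd z"] by (cases z) auto
  next
    fix z assume "z \<in> star u \<times> star v - V \<times> V"
    then show "(case z of (x, y) \<Rightarrow> A x y * c x y) = 0"
      using star_subset uv by blast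
  qed simp
  then show ?thesis
    using finite_star by (simp add: sum.cartesian_product)
qed

lemma coupling_row: "x \<in> V \<Longrightarrow> (\<Sum>y\<in>star v. A x y) = walk_measure E \<epsilon> u x"
proof -
  assume x: "x \<in> V"
  have "((\<lambda>y. A x y) has_sum (\<Sum>y\<in>star v. A x y)) V"
    using star_subset uv x finite_star coupling_outside
    by (intro has_sum_finite_neutralI[where B = "star v"]) auto
  moreover have "((\<lambda>y. A x y) has_sum walk_measure E \<epsilon> u x) V"
    using A x by (auto simp: couplings_def)
  ultimately show ?thesis using has_sum_unique by blast
qed

lemma coupling_column: "y \<in> V \<Longrightarrow> (\<Sum>x\<in>star u. A x y) = walk_measure E \<epsilon> v y"
proof -
  assume y: "y \<in> V"
  have "((\<lambda>x. A x y) has_sum (\<Sum>x\<in>star u. A x y)) V"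
    using star_subset uv y finite_star coupling_outside
    by (intro has_sum_finite_neutralI[where B = "star u"]) auto
  moreover have "((\<lambda>x. A x y) has_sum walk_measure E \<epsilon> v y) V"
    using A y by (auto simp: couplings_def)
  ultimately show ?thesis using has_sum_unique by blast
qed

text \<open>The marginals write both means of \<open>g\<close> as sums against the same
  \<open>A\<close>; their difference is the \<open>A\<close>-average of \<open>g y - g x\<close>,
  which the Lipschitz bound compares with the cost.\<close>

lemma coupling_cost_ge:
  assumes lip: "\<And>x y. x \<in> V \<Longrightarrow> y \<in> V \<Longrightarrow> g y - g x \<le> real (d x y)"
  shows "g v + \<epsilon> * laplacian E g v - (g u + \<epsilon> * laplacian E g u)
           \<le> (\<Sum>\<^sub>\<infinity>(x, y)\<in>V \<times> V. A x y * real (d x y))"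
proof -
  have "g v + \<epsilon> * laplacian E g v = (\<Sum>y\<in>star v. g y * (\<Sum>x\<in>star u. A x y))"
    unfolding sum_walk_measure[symmetric]
    using coupling_column star_subset[OF uv(2)] by (intro sum.cong) auto
  also have "\<dots> = (\<Sum>x\<in>star u. \<Sum>y\<in>star v. A x y * g y)"
    by (subst sum.swap) (simp add: sum_distrib_left mult.commute)
  finally have v: "g v + \<epsilon> * laplacian E g v = (\<Sum>x\<in>star u. \<Sum>y\<in>star v. A x y * g y)" .
  have "g u + \<epsilon> * laplacian E g u = (\<Sum>x\<in>star u. g x * (\<Sum>y\<in>star v. A x y))"
    unfolding sum_walk_measure[symmetric]
    using coupling_row star_subset[OF uv(1)] by (intro sum.cong) auto
  also have "\<dots> = (\<Sum>x\<in>star u. \<Sum>y\<in>star v. A x y * g x)"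
    by (simp add: sum_distrib_left mult.commute)
  finally have u: "g u + \<epsilon> * laplacian E g u = (\<Sum>x\<in>star u. \<Sum>y\<in>star v. A x y * g x)" .
  have "g v + \<epsilon> * laplacian E g v - (g u + \<epsilon> * laplacian E g u)
      = (\<Sum>x\<in>star u. \<Sum>y\<in>star v. A x y * (g y - g x))"
    unfolding u v by (simp add: sum_subtractf right_diff_distrib)
  also have "\<dots> \<le> (\<Sum>x\<in>star u. \<Sum>y\<in>star v. A x y * real (d x y))"
    using star_subset[OF uv(1)] star_subset[OF uv(2)]
    by (intro sum_mono mult_left_mono lip coupling_nonneg) auto
  finally show ?thesis unfolding coupling_cost .
qed

end

text \<open>The product coupling works: for degree at most 3, \<open>\<epsilon> \<le> 1/3\<close>
  keeps the mass left at the centre nonnegative. Lower bounds on costs pass to the infimum only over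
  a nonempty set.\<close>

lemma couplings_nonempty:
  assumes uv: "u \<in> V" "v \<in> V" and "degree E u \<le> 3" "degree E v \<le> 3" "0 < \<epsilon>" "\<epsilon> \<le> 1/3"
  shows "couplings V (walk_measure E \<epsilon> u) (walk_measure E \<epsilon> v) \<noteq> {}"
proof -
  have wm: "walk_measure E \<epsilon> w x \<in> {0..1}" if "degree E w \<le> 3" for w x
  proof -
    have "\<epsilon> * real (degree E w) \<le> 1/3 * 3"
      using that assms by (intro mult_mono) auto
    then show ?thesis using assms by (auto simp: walk_measure_def)
  qed
  have "(\<lambda>x y. walk_measure E \<epsilon> u x * walk_measure E \<epsilon> v y)
          \<in> couplings V (walk_measure E \<epsilon> u) (walk_measure E \<epsilon> v)"
    unfolding couplings_def
    using wm assms has_sum_cmult_right[OF has_sum_walk_measure[OF uv(2)]]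
      has_sum_cmult_left[OF has_sum_walk_measure[OF uv(1)]]
    by (auto simp: mult_le_one dest: spec)
  then show ?thesis by blast
qed

lemma wasserstein_le_cost:
  assumes "u \<in> V" "v \<in> V" "A \<in> couplings V (walk_measure E \<epsilon> u) (walk_measure E \<epsilon> v)"
  shows "wasserstein V E (walk_measure E \<epsilon> u) (walk_measure E \<epsilon> v)
           \<le> (\<Sum>\<^sub>\<infinity>(x, y)\<in>V \<times> V. A x y * real (d x y))"
  unfolding wasserstein_def
proof (rule cINF_lower[OF bdd_belowI2[where m = 0] assms(3)])
  fix A assume "A \<in> couplings V (walk_measure E \<epsilon> u) (walk_measure E \<epsilon> v)"
  \<comment> \<open>The zero test function shows that costs are bounded below, as a real infimum
    requires.\<close>
  from coupling_cost_ge[OF assms(1,2) this, of "\<lambda>_. 0"]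
  show "0 \<le> (\<Sum>\<^sub>\<infinity>(x, y)\<in>V \<times> V. A x y * real (d x y))"
    by (simp add: laplacian_def)
qed

text \<open>Mixing a coupling with the point mass at \<open>(u, v)\<close>: since the measure for \<open>t * \<epsilon>\<close> is a
  convex combination of the measure for \<open>\<epsilon>\<close> and a Dirac measure, the curvature is concave.\<close>

lemma wasserstein_scale:
  assumes uv: "u \<in> V" "v \<in> V" and "degree E u \<le> 3" "degree E v \<le> 3"
    and \<epsilon>: "0 < \<epsilon>" "\<epsilon> \<le> 1/3" and t: "0 < t" "t \<le> 1"
  shows "wasserstein V E (walk_measure E (t * \<epsilon>) u) (walk_measure E (t * \<epsilon>) v)
      \<le> (1 - t) * real (d u v) + t * wasserstein V E (walk_measure E \<epsilon> u) (walk_measure E \<epsilon> v)"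
    (is "?W \<le> _")
proof -
  have mix: "walk_measure E (t * \<epsilon>) w x = (1 - t) * of_bool (x = w) + t * walk_measure E \<epsilon> w x" for w x
    by (simp add: walk_measure_def algebra_simps)
  \<comment> \<open>Rearranged so that the right side is the cost of \<open>A\<close> alone and the
    bound passes to the infimum.\<close>
  have "(?W - (1 - t) * real (d u v)) / t \<le> (\<Sum>\<^sub>\<infinity>(x, y)\<in>V \<times> V. A x y * real (d x y))"
    if A: "A \<in> couplings V (walk_measure E \<epsilon> u) (walk_measure E \<epsilon> v)" for A
  proof -
    define B where "B = (\<lambda>x y. (1 - t) * (of_bool (x = u) * of_bool (y = v)) + t * A x y)"
    have pt: "((\<lambda>x. of_bool (x = w) :: real) has_sum 1) V" if "w \<in> V" for w
      using that by (intro has_sum_finite_neutralI[where B = "{w}"]) auto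
    have B: "B \<in> couplings V (walk_measure E (t * \<epsilon>) u) (walk_measure E (t * \<epsilon>) v)"
      unfolding couplings_def
    proof (intro CollectI conjI ballI)
      fix x y assume "x \<in> V" "y \<in> V"
      then have "A x y \<in> {0..1}" using A by (auto simp: couplings_def)
      then have "0 \<le> t * A x y" "t * A x y \<le> t * 1" "t * A x y \<le> 1"
        using t by (auto intro: mult_le_one)
      then show "B x y \<in> {0..1}" unfolding B_def using t by auto
    next
      fix x assume "x \<in> V"
      then have "((\<lambda>y. A x y) has_sum walk_measure E \<epsilon> u x) V"
        using A by (auto simp: couplings_def)
      from has_sum_add[OF has_sum_cmult_right[OF has_sum_cmult_right[OF pt[OF uv(2)], of "of_bool (x = u)"],
            of "1 - t"] has_sum_cmult_right[OF this, of t]]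
      show "(B x has_sum walk_measure E (t * \<epsilon>) u x) V"
        unfolding B_def mix by simp
    next
      fix y assume "y \<in> V"
      then have "((\<lambda>x. A x y) has_sum walk_measure E \<epsilon> v y) V"
        using A by (auto simp: couplings_def)
      from has_sum_add[OF has_sum_cmult_right[OF has_sum_cmult_left[OF pt[OF uv(1)], of "of_bool (y = v)"],
            of "1 - t"] has_sum_cmult_right[OF this, of t]]
      show "((\<lambda>x. B x y) has_sum walk_measure E (t * \<epsilon>) v y) V"
        unfolding B_def mix by simp
    qed
    have "(\<Sum>x\<in>star u. \<Sum>y\<in>star v. (of_bool (x = u) * of_bool (y = v)) * real (d x y)) = real (d u v)"
    proof -
      have "(\<Sum>y\<in>star v. (of_bool (x = u) * of_bool (y = v)) * real (d x y))
           = (\<Sum>y\<in>star v. if v = y then of_bool (x = u) * real (d x y) else 0)" for x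
        by (intro sum.cong) auto
      also have "\<dots> x = (if u = x then real (d x v) else 0)" for x
        using finite_star by (subst sum.delta') auto
      finally have "(\<Sum>x\<in>star u. \<Sum>y\<in>star v. (of_bool (x = u) * of_bool (y = v)) * real (d x y))
          = (\<Sum>x\<in>star u. if u = x then real (d x v) else 0)" by (rule sum.cong[OF refl])
      then show ?thesis using finite_star by simp
    qed
    moreover have "(\<Sum>x\<in>star u. \<Sum>y\<in>star v. B x y * real (d x y))
        = (1 - t) * (\<Sum>x\<in>star u. \<Sum>y\<in>star v. (of_bool (x = u) * of_bool (y = v)) * real (d x y))
          + t * (\<Sum>x\<in>star u. \<Sum>y\<in>star v. A x y * real (d x y))"
      unfolding B_def sum_distrib_left sum.distrib[symmetric]
      by (intro sum.cong refl) (simp add: algebra_simps)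
    ultimately have "?W \<le> (1 - t) * real (d u v) + t * (\<Sum>\<^sub>\<infinity>(x, y)\<in>V \<times> V. A x y * real (d x y))"
      using wasserstein_le_cost[OF uv B] coupling_cost[OF uv A] coupling_cost[OF uv B] by simp
    then show ?thesis using t by (simp add: field_simps)
  qed
  then have "(?W - (1 - t) * real (d u v)) / t \<le> wasserstein V E (walk_measure E \<epsilon> u) (walk_measure E \<epsilon> v)"
    unfolding wasserstein_def[of V E "walk_measure E \<epsilon> u"]
    using couplings_nonempty assms by (intro cINF_greatest) auto
  then show ?thesis using t by (simp add: field_simps)
qed

text \<open>Weak Kantorovich duality. As \<open>curvature\<close> is a \<open>Lim\<close>, its convergence has to be
  established: the quotients are antitone in \<open>\<epsilon>\<close> and bounded.\<close>

lemma curvature_le_laplacian: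
  assumes e: "(u, v) \<in> E" and deg: "degree E u \<le> 3" "degree E v \<le> 3"
    and lip: "\<And>x y. x \<in> V \<Longrightarrow> y \<in> V \<Longrightarrow> g y - g x \<le> real (d x y)"
    and g: "g v = g u + 1"
  shows "curvature V E u v \<le> laplacian E g u - laplacian E g v"
proof -
  have uv: "u \<in> V" "v \<in> V" and duv: "d u v = 1" using e edge_V gdist_edge by auto
  define W where "W = (\<lambda>\<epsilon>. wasserstein V E (walk_measure E \<epsilon> u) (walk_measure E \<epsilon> v))"
  define k where "k = (\<lambda>\<epsilon>. 1 / \<epsilon> * curvature_eps V E \<epsilon> u v)"
  define M where "M = laplacian E g u - laplacian E g v"
  have k: "k \<epsilon> = (1 - W \<epsilon>) / \<epsilon>" for \<epsilon> by (simp add: k_def curvature_eps_def duv W_def)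
  have le: "k \<epsilon> \<le> M" if "0 < \<epsilon>" "\<epsilon> \<le> 1/3" for \<epsilon>
  proof -
    have "1 - \<epsilon> * M \<le> W \<epsilon>"
      unfolding W_def wasserstein_def
    proof (rule cINF_greatest)
      show "couplings V (walk_measure E \<epsilon> u) (walk_measure E \<epsilon> v) \<noteq> {}"
        using couplings_nonempty uv deg that by blast
      fix A assume "A \<in> couplings V (walk_measure E \<epsilon> u) (walk_measure E \<epsilon> v)"
      from coupling_cost_ge[OF uv this lip]
      show "1 - \<epsilon> * M \<le> (\<Sum>\<^sub>\<infinity>(x, y)\<in>V \<times> V. A x y * real (d x y))"
        using g by (simp add: M_def algebra_simps)
    qed
    then show ?thesis using that by (simp add: k field_simps)
  qed
  \<comment> \<open>Scaling by the factor \<open>t = s / \<epsilon>\<close>.\<close>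
  have anti: "k \<epsilon> \<le> k s" if "0 < s" "s \<le> \<epsilon>" "\<epsilon> \<le> 1/3" for s \<epsilon>
  proof -
    have "W s \<le> (1 - s / \<epsilon>) + s / \<epsilon> * W \<epsilon>"
      using wasserstein_scale[OF uv deg, of \<epsilon> "s / \<epsilon>"] that by (simp add: W_def duv)
    then have "s / \<epsilon> * (1 - W \<epsilon>) \<le> 1 - W s" by (simp add: algebra_simps)
    then show ?thesis using that by (simp add: k field_simps)
  qed
  \<comment> \<open>A bounded quotient that only grows as \<open>\<epsilon>\<close> decreases to 0
    tends to its supremum.\<close>
  define L where "L = (SUP \<epsilon>\<in>{0<..1/3}. k \<epsilon>)"
  have bdd: "bdd_above (k ` {0<..1/3})" using le by (intro bdd_aboveI2[where M = M]) auto
  have L_upper: "k \<epsilon> \<le> L" if "0 < \<epsilon>" "\<epsilon> \<le> 1/3" for \<epsilon>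
    unfolding L_def using that by (intro cSUP_upper bdd) auto
  have small: "\<forall>\<^sub>F \<epsilon> in at_right 0. 0 < \<epsilon> \<and> \<epsilon> \<le> c" if "0 < c" for c :: real
    using that by (auto simp: eventually_at_right_field intro!: exI[of _ c])
  have "(k \<longlongrightarrow> L) (at_right 0)"
  proof (rule order_tendstoI)
    fix a assume "a < L"
    then obtain c where c: "0 < c" "c \<le> 1/3" "a < k c"
      unfolding L_def using less_cSUP_iff[OF _ bdd] by auto
    show "\<forall>\<^sub>F \<epsilon> in at_right 0. a < k \<epsilon>"
      using small[OF c(1)] by eventually_elim (use c anti less_le_trans in blast)
  next
    fix a assume "L < a"
    have "0 < (1 :: real) / 3" by simp
    from small[OF this] show "\<forall>\<^sub>F \<epsilon> in at_right 0. k \<epsilon> < a"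
      by eventually_elim (use \<open>L < a\<close> L_upper le_less_trans in blast)
  qed
  then have "curvature V E u v = L"
    unfolding curvature_def k_def[symmetric] by (intro tendsto_Lim) auto
  also have "L \<le> M" unfolding L_def using le by (intro cSUP_least) auto
  finally show ?thesis by (simp add: M_def)
qed

end

section \<open>Neighbours of a geodesic\<close>

locale nonneg_curved_graph = lfc_graph +
  assumes degree_le_3: "u \<in> V \<Longrightarrow> degree E u \<le> 3"
    and curvature_nonneg: "(u, v) \<in> E \<Longrightarrow> 0 \<le> curvature V E u v"
begin

lemma laplacian_comparison:
  assumes "(u, v) \<in> E" "\<And>x y. x \<in> V \<Longrightarrow> y \<in> V \<Longrightarrow> g y - g x \<le> real (d x y)" "g v = g u + 1"
  shows "laplacian E g v \<le> laplacian E g u"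
  using curvature_le_laplacian[OF assms(1) _ _ assms(2,3)] curvature_nonneg[OF assms(1)]
    degree_le_3 edge_V[OF assms(1)] by force

text \<open>The neighbour of \<open>u\<close> off a geodesic \<open>a, u, b\<close>. If \<open>u\<close> has degree 2, we set \<open>x = u\<close>,
  which keeps the formula for the Laplacian valid.\<close>

definition off_nbr :: "'a \<Rightarrow> 'a \<Rightarrow> 'a \<Rightarrow> 'a \<Rightarrow> bool" where
  "off_nbr a u b x \<longleftrightarrow> (u, a) \<in> E \<and> (u, b) \<in> E \<and> a \<noteq> b \<and> x \<noteq> a \<and> x \<noteq> b \<and> star u = {u, a, b, x}"

lemma off_nbr_commute: "off_nbr a u b x \<longleftrightarrow> off_nbr b u a x"
  by (auto simp: off_nbr_def)

lemma off_nbr_exists: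
  assumes "(u, a) \<in> E" "(u, b) \<in> E" "a \<noteq> b"
  shows "\<exists>x. off_nbr a u b x"
proof (cases "E `` {u} = {a, b}")
  case True
  then have "off_nbr a u b u" using assms edge_neq by (auto simp: off_nbr_def)
  then show ?thesis by blast
next
  case False
  then obtain x where x: "(u, x) \<in> E" "x \<noteq> a" "x \<noteq> b" using assms by auto
  have "{a, b, x} = E `` {u}"
    using x assms finite_nbrs degree_le_3[of u] edge_V[of u a]
    by (intro card_seteq) (auto simp: degree_def)
  then have "off_nbr a u b x" using x assms by (auto simp: off_nbr_def)
  then show ?thesis by blast
qed

lemma off_nbr_D:
  assumes "off_nbr a u b x"
  shows "(u, a) \<in> E" "(u, b) \<in> E" "a \<in> V" "u \<in> V" "b \<in> V" "x \<in> V" "d u x \<le> 1" "x \<noteq> a" "x \<noteq> b"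
proof -
  show e: "(u, a) \<in> E" "(u, b) \<in> E" "x \<noteq> a" "x \<noteq> b" using assms by (auto simp: off_nbr_def)
  show "a \<in> V" "u \<in> V" "b \<in> V" using e edge_V by auto
  have "x \<in> star u" using assms by (auto simp: off_nbr_def)
  then show "x \<in> V" "d u x \<le> 1" using star_subset[OF \<open>u \<in> V\<close>] gdist_le_1[of u x] \<open>u \<in> V\<close> by auto
qed

lemma off_nbr_cases:
  assumes "off_nbr a u b x" "(u, y) \<in> E"
  shows "y = a \<or> y = b \<or> y = x"
proof -
  have "y \<in> star u" "y \<noteq> u" using assms edge_neq by auto
  then show ?thesis using assms by (auto simp: off_nbr_def)
qed

text \<open>The test function is 0, 1, 2, 3 along \<open>a\<close>, \<open>u\<close>,
  \<open>v\<close>, \<open>b\<close>, at most 1 at \<open>x\<close> and at least 3 at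
  \<open>y\<close>. Its Laplacian is then at most 0 at \<open>u\<close> but at least 1 at
  \<open>v\<close>, against \<open>laplacian_comparison\<close>.\<close>

lemma geodesic_edge_aux:
  assumes x: "off_nbr a u v x" and y: "off_nbr u v b y"
    and dab: "d a b = 3" and "3 \<le> d a y" "2 \<le> d x y" "2 \<le> d x b"
  shows False
proof -
  note V = off_nbr_D(3-6)[OF x] off_nbr_D(5,6)[OF y]
  have e: "(a, u) \<in> E" "(u, v) \<in> E" "(v, b) \<in> E"
    using off_nbr_D(1,2)[OF x] off_nbr_D(1,2)[OF y] edge_sym by auto
  have "d a b \<le> d a v + d v b" "d a v \<le> d a u + d u v"
    using V by (auto intro: gdist_triangle)
  then have da: "d a u = 1" "d a v = 2"
    using gdist_edge[OF e(1)] gdist_edge[OF e(2)] gdist_edge[OF e(3)] dab by auto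
  have "1 \<le> d x v" using gdist_eq_0[of x v] V off_nbr_D(9)[OF x] by auto
  \<comment> \<open>The distance from \<open>a\<close>, pushed down to at most 1 at \<open>x\<close>
    by a cone with tip at \<open>x\<close>. The assumed distance bounds keep the cone from lowering
    \<open>b\<close> or \<open>y\<close> below 3.\<close>
  define g where "g = (\<lambda>z. min (real (d a z)) (1 + real (d x z)))"
  have g: "g a = 0" "g u = 1" "g v = 2" "g b = 3" "g x \<le> 1" "3 \<le> g y"
    using da dab assms(4-) \<open>1 \<le> d x v\<close> by (auto simp: g_def)
  have "laplacian E g v \<le> laplacian E g u"
  proof (rule laplacian_comparison[OF e(2)])
    fix s t assume "s \<in> V" "t \<in> V"
    then have "d a t \<le> d a s + d s t" "d x t \<le> d x s + d s t"
      using V by (auto intro: gdist_triangle)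
    then show "g t - g s \<le> real (d s t)" by (auto simp: g_def)
  qed (use g in simp)
  moreover have "laplacian E g u = g a + g v + g x - 3 * g u"
    using x by (intro laplacian_off) (auto simp: off_nbr_def)
  moreover have "laplacian E g v = g u + g b + g y - 3 * g v"
    using y by (intro laplacian_off) (auto simp: off_nbr_def)
  ultimately show False using g by simp
qed

text \<open>What the obstruction of \<open>geodesic_edge_aux\<close> and its mirror image leave
  over. This is the only form in which curvature enters the analysis of geodesics below.\<close>

lemma geodesic_edge:
  assumes x: "off_nbr a u v x" and y: "off_nbr u v b y" and dab: "d a b = 3"
  shows "d x y \<le> 1 \<or> d x b \<le> 1 \<or> d a y \<le> 1 \<or> (d a y \<le> 2 \<and> d x b \<le> 2)"
proof -
  note V = off_nbr_D(3,6)[OF x] off_nbr_D(5,6)[OF y]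
  have "\<not> (3 \<le> d a y \<and> 2 \<le> d x y \<and> 2 \<le> d x b)"
    using geodesic_edge_aux[OF x y dab] by blast
  \<comment> \<open>The same obstruction for the geodesic read backwards: \<open>b\<close>,
    \<open>v\<close>, \<open>u\<close>, \<open>a\<close>.\<close>
  moreover have "\<not> (3 \<le> d x b \<and> 2 \<le> d x y \<and> 2 \<le> d a y)"
    using geodesic_edge_aux[of b v u y a x] x y dab V off_nbr_commute[of a u v x]
      off_nbr_commute[of u v b y] gdist_sym[of a b] gdist_sym[of a y] gdist_sym[of x y] gdist_sym[of x b]
    by auto
  ultimately show ?thesis by linarith
qed

text \<open>A geodesic segment of length 8. Integer indices centred at 0 turn reversal into
  \<open>i \<mapsto> - i\<close>, so one-sided arguments apply to both sides; these reach as far as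
  \<open>p 4\<close>.\<close>

definition window :: "(int \<Rightarrow> 'a) \<Rightarrow> bool" where
  "window p \<longleftrightarrow> (\<forall>i\<in>{-4..4}. \<forall>j\<in>{-4..4}. p i \<in> V \<and> int (d (p i) (p j)) = \<bar>i - j\<bar>)"

lemma window_reverse: "window p \<Longrightarrow> window (\<lambda>i. p (- i))"
  unfolding window_def by force

context
  fixes p :: "int \<Rightarrow> 'a"
  assumes p: "window p"
begin

lemma window_V: "-4 \<le> i \<Longrightarrow> i \<le> 4 \<Longrightarrow> p i \<in> V"
  using p by (auto simp: window_def)

lemma window_dist: "-4 \<le> i \<Longrightarrow> i \<le> 4 \<Longrightarrow> -4 \<le> j \<Longrightarrow> j \<le> 4 \<Longrightarrow> int (d (p i) (p j)) = \<bar>i - j\<bar>"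
  using p by (auto simp: window_def)

lemma window_edge: "-4 \<le> i \<Longrightarrow> i \<le> 4 \<Longrightarrow> -4 \<le> j \<Longrightarrow> j \<le> 4 \<Longrightarrow> \<bar>i - j\<bar> = 1 \<Longrightarrow> (p i, p j) \<in> E"
  using window_dist[of i j] gdist_eq_1[of "p i" "p j"] window_V by simp

text \<open>The triangle inequality through \<open>x\<close>; it serves to exclude vertices near two
  points that are far apart on the geodesic.\<close>

lemma window_near:
  assumes "x \<in> V" "d (p i) x \<le> m" "d x (p j) \<le> n" "i \<in> {-4..4}" "j \<in> {-4..4}"
  shows "\<bar>i - j\<bar> \<le> int m + int n"
proof -
  have "d (p i) (p j) \<le> d (p i) x + d x (p j)"
    using assms window_V by (intro gdist_triangle) auto
  then show ?thesis using assms window_dist[of i j] by auto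
qed

lemma window_off:
  assumes "-3 \<le> i" "i \<le> 3"
  shows "\<exists>x. off_nbr (p (i - 1)) (p i) (p (i + 1)) x"
proof (rule off_nbr_exists)
  show "p (i - 1) \<noteq> p (i + 1)"
    using window_dist[of "i - 1" "i + 1"] assms by auto
qed (use window_edge assms in auto)

end

section \<open>Tubes around geodesics\<close>

text \<open>Otherwise \<open>w\<close> would have four neighbours.\<close>

lemma nbr_unique:
  assumes "(w, a) \<in> E" "(w, b) \<in> E" "(w, s) \<in> E" "(w, t) \<in> E"
    and "a \<noteq> b" "s \<noteq> a" "s \<noteq> b" "t \<noteq> a" "t \<noteq> b"
  shows "s = t"
proof (rule ccontr)
  assume "s \<noteq> t"
  then have "card {a, b, s, t} = 4" using assms by auto
  moreover have "card {a, b, s, t} \<le> card (E `` {w})"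
    using assms finite_nbrs by (intro card_mono) auto
  ultimately show False
    using degree_le_3[of w] edge_V[OF assms(1)] by (simp add: degree_def)
qed

text \<open>The configuration that would violate \<open>tube\<close>; the lemmas about it lead to
  the contradiction in \<open>no_branch\<close>.\<close>

definition branch :: "(int \<Rightarrow> 'a) \<Rightarrow> 'a \<Rightarrow> 'a \<Rightarrow> bool" where
  "branch p w z \<longleftrightarrow> window p \<and> (p 0, w) \<in> E \<and> (w, z) \<in> E \<and> (\<forall>i\<in>{-4..4}. 2 \<le> d z (p i))"

lemma branch_reverse: "branch p w z \<Longrightarrow> branch (\<lambda>i. p (- i)) w z"
  using window_reverse unfolding branch_def by force

context
  fixes p w z
  assumes br: "branch p w z"
begin

lemma branch_window: "window p"
  using br by (simp add: branch_def)

lemma branch_V: "w \<in> V" "z \<in> V" "-4 \<le> i \<Longrightarrow> i \<le> 4 \<Longrightarrow> p i \<in> V"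
  using br edge_V window_V[OF branch_window] by (auto simp: branch_def)

lemma branch_edge: "(w, p 0) \<in> E" "(p 0, w) \<in> E" "(w, z) \<in> E"
  using br edge_sym by (auto simp: branch_def)

lemma branch_far: "-4 \<le> i \<Longrightarrow> i \<le> 4 \<Longrightarrow> 2 \<le> d z (p i)"
  using br by (auto simp: branch_def)

lemma branch_z_neq: "-4 \<le> i \<Longrightarrow> i \<le> 4 \<Longrightarrow> d t (p i) \<le> 1 \<Longrightarrow> t \<noteq> z"
  using branch_far[of i] by auto

lemma branch_w_off: "-4 \<le> i \<Longrightarrow> i \<le> 4 \<Longrightarrow> w \<noteq> p i"
  using branch_far[of i] gdist_edge[OF branch_edge(3)] gdist_sym[of w z] branch_V(1,2)
  by auto

lemma branch_off_nbr: "off_nbr (p (-1)) (p 0) (p 1) w"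
proof -
  obtain x where x: "off_nbr (p (-1)) (p 0) (p 1) x"
    using window_off[OF branch_window, of 0] by auto
  then have "w = x"
    using off_nbr_cases[OF x branch_edge(2)] branch_w_off[of 1] branch_w_off[of "-1"] by auto
  then show ?thesis using x by simp
qed

text \<open>This is \<open>geodesic_edge\<close> at the edge from \<open>p 0\<close> to
  \<open>p 1\<close>, with off neighbours \<open>w\<close> and \<open>y\<close>. If \<open>y\<close>
  is near \<open>p (-1)\<close>, it closes a 4-cycle with \<open>p (-1)\<close>, \<open>p 0\<close>,
  \<open>p 1\<close>; every other alternative gives \<open>w\<close> a further neighbour
  \<open>t\<close> near the right side.\<close>

lemma branch_right:
  "(\<exists>y. off_nbr (p 0) (p 1) (p 2) y \<and> (y, p (-1)) \<in> E \<and> (y, p 1) \<in> E)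
       \<or> (\<exists>t. (w, t) \<in> E \<and> t \<noteq> p 0 \<and> (d t (p 1) \<le> 1 \<or> d t (p 2) \<le> 1))"
proof -
  note win = branch_window
  obtain y where y: "off_nbr (p 0) (p 1) (p 2) y" using window_off[OF win, of 1] by auto
  note yV = off_nbr_D[OF y]
  have d_ab: "d (p (-1)) (p 2) = 3" using window_dist[OF win, of "-1" 2] by simp
  have d2: "d (p 0) (p 2) = 2" using window_dist[OF win, of 0 2] by simp
  consider (a) "d w y \<le> 1" | (b) "d w (p 2) \<le> 1" | (c) "d (p (-1)) y \<le> 1" | (d) "d w (p 2) = 2"
    using geodesic_edge[OF branch_off_nbr y d_ab] by linarith
  then show ?thesis
  proof cases
    case a
    show ?thesis
    proof (cases "w = y")
      \<comment> \<open>Here \<open>w\<close> itself is adjacent to \<open>p 1\<close>, so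
        \<open>t = p 1\<close> serves.\<close>
      case True
      then have "(w, p 1) \<in> E"
        using yV(7) branch_w_off[of 1] gdist_le_1[of "p 1" w] branch_V edge_sym by auto
      then show ?thesis using yV(8) edge_neq[OF yV(1)] by force
    next
      case False
      then have "(w, y) \<in> E" using a gdist_le_1 branch_V yV(6) by blast
      then show ?thesis using yV gdist_sym[of y "p 1"] by auto
    qed
  next
    case b
    then have "(w, p 2) \<in> E"
      using branch_w_off[of 2] gdist_le_1[of w "p 2"] branch_V by auto
    then show ?thesis using d2 by force
  next
    case c
    \<comment> \<open>This excludes the default \<open>y = p 1\<close> of the degree 2 case.\<close>
    then have "y \<noteq> p 1" using window_dist[OF win, of "-1" 1] by auto
    moreover have "y \<noteq> p (-1)"
      using yV(7) window_dist[OF win, of 1 "-1"] by auto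
    ultimately have "(y, p (-1)) \<in> E" "(y, p 1) \<in> E"
      using c yV(4,6,7) gdist_le_1[of "p (-1)" y] gdist_le_1[of "p 1" y] branch_V edge_sym by auto
    then show ?thesis using y by blast
  next
    case d
    then obtain t where t: "(w, t) \<in> E" "(t, p 2) \<in> E"
      using gdist_2_common_nbr[of w "p 2"] branch_V by auto
    then have "t \<noteq> p 0" using d2 gdist_edge[OF t(2)] by auto
    then show ?thesis using t gdist_edge[OF t(2)] by auto
  qed
qed

text \<open>Such an edge would exhaust the neighbours of \<open>w\<close> with \<open>p 0\<close>,
  \<open>p 2\<close>, \<open>z\<close> and make \<open>w\<close> the off neighbour of
  \<open>p 2\<close>. Then \<open>geodesic_edge\<close> fails at the edge from \<open>p 2\<close> to
  \<open>p 3\<close>: \<open>w\<close> has no neighbour left, is too far from \<open>p 4\<close>,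
  and the neighbours of \<open>p 1\<close> are too far from the off neighbour of
  \<open>p 3\<close>.\<close>

lemma branch_not_square: "(w, p 2) \<notin> E" if y: "off_nbr (p 0) (p 1) (p 2) y" "(y, p (-1)) \<in> E"
proof
  assume w2: "(w, p 2) \<in> E"
  note win = branch_window
  have "p 0 \<noteq> p 2" using window_dist[OF win, of 0 2] by auto
  then have nbrs_w: "t = p 0 \<or> t = p 2 \<or> t = z" if "(w, t) \<in> E" for t
    using nbr_unique[OF branch_edge(1) w2 branch_edge(3) that] branch_z_neq[of 0 "p 0"]
      branch_z_neq[of 2 "p 2"] window_dist[OF win, of 0 2] by auto
  have w0: "d (p 0) w \<le> 1" using gdist_edge[OF branch_edge(2)] by simp
  have w_near: "j \<le> 1 + int n" if "d w (p j) \<le> n" "0 \<le> j" "j \<le> 4" for j n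
    using window_near[OF win _ w0 that(1)] branch_V(1) that by auto
  obtain v where v: "off_nbr (p 1) (p 2) (p 3) v" using window_off[OF win, of 2] by auto
  have "v = w"
    using off_nbr_cases[OF v edge_sym[OF w2]] branch_w_off[of 1] branch_w_off[of 3] by auto
  then have ow: "off_nbr (p 1) (p 2) (p 3) w" using v by simp
  obtain s where s: "off_nbr (p 2) (p 3) (p 4) s" using window_off[OF win, of 3] by auto
  note sV = off_nbr_D[OF s]
  have s3: "d s (p 3) \<le> 1" using sV gdist_sym[of s "p 3"] by auto
  have "d (p 1) (p 4) = 3" using window_dist[OF win, of 1 4] by simp
  then consider (a) "d w s \<le> 1" | (b) "d w (p 4) \<le> 2" | (c) "d (p 1) s \<le> 1"
    using geodesic_edge[OF ow s] by linarith
  then show False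
  proof cases
    case a
    have "w \<noteq> s" using w_near[of 3 1] s3 by auto
    then have "(w, s) \<in> E" using a gdist_le_1 branch_V sV(6) by blast
    then have "s = p 0" using nbrs_w[of s] sV(8) branch_z_neq[OF _ _ s3] by auto
    then show False using s3 window_dist[OF win, of 0 3] by auto
  next
    case b
    then show False using w_near[of 4 2] by auto
  next
    case c
    have "s = y \<or> s = p 0 \<or> s = p 1"
      using c gdist_le_1[of "p 1" s] branch_V sV off_nbr_cases[OF y(1), of s] by auto
    then have "s = y"
      using s3 window_dist[OF win, of 0 3] window_dist[OF win, of 1 3] by auto
    then have "d (p (-1)) s \<le> 1" using gdist_edge[OF edge_sym[OF y(2)]] by simp
    then show False using window_near[OF win sV(6) _ s3, of "-1" 1] by auto
  qed
qed

text \<open>Now \<open>geodesic_edge\<close> is applied at the edge from \<open>p 1\<close> to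
  \<open>p 2\<close>, where \<open>y\<close> is the off neighbour of \<open>p 1\<close>. It asks for
  a third neighbour of \<open>y\<close>, unless \<open>w\<close> is adjacent to \<open>p 2\<close>,
  which \<open>branch_not_square\<close> excludes.\<close>

lemma branch_square_right:
  assumes y: "off_nbr (p 0) (p 1) (p 2) y" "(y, p (-1)) \<in> E"
  shows "\<exists>s. (y, s) \<in> E \<and> s \<noteq> p 1 \<and> s \<noteq> p (-1) \<and> (d s (p 2) \<le> 1 \<or> d s (p 3) \<le> 1)"
proof -
  note win = branch_window
  note yV = off_nbr_D[OF y(1)]
  \<comment> \<open>Being adjacent to \<open>p (-1)\<close>, the vertex \<open>y\<close> is no
    closer to \<open>p j\<close> than \<open>p 0\<close> is.\<close>
  have y_near: "j \<le> int n" if "d y (p j) \<le> n" "0 \<le> j" "j \<le> 4" for j n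
    using window_near[OF win yV(6) _ that(1), of "-1" 1] that gdist_edge[OF edge_sym[OF y(2)]] by auto
  obtain s where s: "off_nbr (p 1) (p 2) (p 3) s" using window_off[OF win, of 2] by auto
  note sV = off_nbr_D[OF s]
  have s2: "d s (p 2) \<le> 1" using sV gdist_sym[of s "p 2"] by auto
  have ns: "t \<noteq> p (-1)" if "d t (p 2) \<le> 1 \<or> d t (p 3) \<le> 1" for t
    using that window_dist[OF win, of "-1" 2] window_dist[OF win, of "-1" 3] by auto
  have "d (p 0) (p 3) = 3" using window_dist[OF win, of 0 3] by simp
  then consider (a) "d y s \<le> 1" | (b) "d y (p 3) \<le> 2" | (c) "d (p 0) s \<le> 1"
    using geodesic_edge[OF y(1) s] by linarith
  then show ?thesis
  proof cases
    case a
    have "y \<noteq> s" using y_near[of 2 1] s2 by auto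
    then have "(y, s) \<in> E" using a gdist_le_1 sV(6) yV(6) by blast
    then show ?thesis using s2 sV(8) ns by blast
  next
    case b
    then have "d y (p 3) = 2 \<or> d y (p 3) \<le> 1" by linarith
    then have "d y (p 3) = 2" using y_near[of 3 1] by auto
    then obtain t where t: "(y, t) \<in> E" "(t, p 3) \<in> E"
      using gdist_2_common_nbr[of y "p 3"] yV(6) sV(5) by auto
    have t3: "d t (p 3) \<le> 1" using gdist_edge[OF t(2)] by simp
    then have "t \<noteq> p 1" using window_dist[OF win, of 1 3] by auto
    then show ?thesis using t t3 ns by blast
  next
    case c
    have "s = w \<or> s = p 0 \<or> s = p (-1)"
      using c gdist_le_1[of "p 0" s] branch_V sV off_nbr_cases[OF branch_off_nbr, of s] by auto
    moreover have "s \<noteq> p 0" using s2 window_dist[OF win, of 0 2] by auto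
    ultimately have "s = w" using ns s2 by blast
    then have "(w, p 2) \<in> E"
      using s2 gdist_le_1[of w "p 2"] branch_V branch_w_off[of 2] by auto
    then show ?thesis using branch_not_square y by blast
  qed
qed

end

text \<open>Besides \<open>p 0\<close> and \<open>z\<close>, the vertex \<open>w\<close> has at most one neighbour, which cannot serve both
  edges of the geodesic at \<open>p 0\<close>. So \<open>p (-1)\<close> and \<open>p 1\<close> share a neighbour \<open>y\<close>, and now the only
  free neighbour of \<open>y\<close> would have to serve the next edge on both sides.\<close>

lemma no_branch: "\<not> branch p w z"
proof
  assume br: "branch p w z"
  note win = branch_window[OF br]
  let ?q = "\<lambda>i. p (- i)"
  note br' = branch_reverse[OF br]
  have right: "(\<exists>y. off_nbr (p 0) (p 1) (p 2) y \<and> (y, p (-1)) \<in> E \<and> (y, p 1) \<in> E)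
       \<or> (\<exists>t. (w, t) \<in> E \<and> t \<noteq> p 0 \<and> (d t (p 1) \<le> 1 \<or> d t (p 2) \<le> 1))"
    by (rule branch_right[OF br])
  have left: "(\<exists>y. off_nbr (p 0) (p (-1)) (p (-2)) y \<and> (y, p 1) \<in> E \<and> (y, p (-1)) \<in> E)
       \<or> (\<exists>t. (w, t) \<in> E \<and> t \<noteq> p 0 \<and> (d t (p (-1)) \<le> 1 \<or> d t (p (-2)) \<le> 1))"
    using branch_right[OF br'] by simp
  have "\<exists>y. y \<noteq> p 0 \<and> (y, p (-1)) \<in> E \<and> (y, p 1) \<in> E"
  proof (rule ccontr)
    assume none: "\<not> ?thesis"
    then obtain t where t: "(w, t) \<in> E" "t \<noteq> p 0" "d t (p 1) \<le> 1 \<or> d t (p 2) \<le> 1"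
      using right off_nbr_D(8) by blast
    from none obtain t' where t': "(w, t') \<in> E" "t' \<noteq> p 0" "d t' (p (-1)) \<le> 1 \<or> d t' (p (-2)) \<le> 1"
      using left off_nbr_D(8) by blast
    have "t \<noteq> z" using t(3) branch_z_neq[OF br, of 1 t] branch_z_neq[OF br, of 2 t] by auto
    moreover have "t' \<noteq> z"
      using t'(3) branch_z_neq[OF br, of "-1" t'] branch_z_neq[OF br, of "-2" t'] by auto
    moreover have "p 0 \<noteq> z" using branch_z_neq[OF br, of 0 "p 0"] by simp
    ultimately have "t' = t"
      using nbr_unique[OF branch_edge(1)[OF br] branch_edge(3)[OF br] t(1) t'(1)] t t' by auto
    have tV: "t \<in> V" using t edge_V by blast
    \<comment> \<open>Indices on the two sides differ by at most 2 if \<open>t\<close> is near both,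
      which leaves only \<open>-1\<close> and \<open>1\<close>.\<close>
    have "d t (p (-1)) \<le> 1" "d t (p 1) \<le> 1"
      using t(3) t'(3) \<open>t' = t\<close> gdist_sym[of t] tV window_V[OF win]
        window_near[OF win tV, of "-1" 1 2 1] window_near[OF win tV, of "-2" 1 2 1] window_near[OF win tV, of "-2" 1 1 1]
      by auto
    then have "(t, p (-1)) \<in> E" "(t, p 1) \<in> E"
      using gdist_le_1[of t "p 1"] gdist_le_1[of t "p (-1)"] tV window_V[OF win]
        window_dist[OF win, of 1 "-1"] window_dist[OF win, of "-1" 1] by auto
    then show False using none t(2) by blast
  qed
  then obtain y where y: "y \<noteq> p 0" "(y, p (-1)) \<in> E" "(y, p 1) \<in> E" by blast
  have yV: "y \<in> V" using y edge_V by blast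
  \<comment> \<open>Stated for any window so that it applies to \<open>p\<close> and to its
    reversal.\<close>
  have off: "off_nbr (p 0) (q 1) (q 2) y"
    if "window q" "q 0 = p 0" "(y, q 1) \<in> E" "(y, q (-1)) \<in> E" for q :: "int \<Rightarrow> 'a"
  proof -
    note q = that
    obtain x where x: "off_nbr (q 0) (q 1) (q 2) x" using window_off[OF q(1), of 1] by auto
    have "y \<noteq> q 2"
      using gdist_edge[OF q(4)] window_dist[OF q(1), of 2 "-1"] by auto
    then have "y = x" using off_nbr_cases[OF x edge_sym[OF q(3)]] y(1) q(2) by auto
    then show ?thesis using x q(2) by simp
  qed
  obtain s where s: "(y, s) \<in> E" "s \<noteq> p 1" "s \<noteq> p (-1)" "d s (p 2) \<le> 1 \<or> d s (p 3) \<le> 1"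
    using branch_square_right[OF br off[OF win _ y(3,2)] y(2)] by auto
  have "off_nbr (?q 0) (?q 1) (?q 2) y"
    using off[OF branch_window[OF br']] y by simp
  from branch_square_right[OF br' this] obtain s' where
    s': "(y, s') \<in> E" "s' \<noteq> p 1" "s' \<noteq> p (-1)" "d s' (p (-2)) \<le> 1 \<or> d s' (p (-3)) \<le> 1"
    using y by auto
  have "p 1 \<noteq> p (-1)" using window_dist[OF win, of 1 "-1"] by auto
  then have "s' = s" using nbr_unique[OF y(3,2) s(1) s'(1)] s s' by auto
  have sV: "s \<in> V" using s edge_V by blast
  \<comment> \<open>The vertex \<open>s\<close> is within 1 of points with indices at least 2 and at
    most -2, which are at distance at least 4.\<close>
  show False
    using s(4) s'(4) \<open>s' = s\<close> gdist_sym[of s] sV window_V[OF win]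
      window_near[OF win sV, of "-2" 1 2 1] window_near[OF win sV, of "-3" 1 2 1]
      window_near[OF win sV, of "-2" 1 3 1] window_near[OF win sV, of "-3" 1 3 1] by auto
qed

text \<open>The form of \<open>no_branch\<close> used as induction step when a second geodesic is
  followed along the first.\<close>

lemma tube:
  assumes win: "window p" and "d (p 0) w \<le> 1" "w \<in> V" "(w, z) \<in> E"
  shows "\<exists>i\<in>{-4..4}. d z (p i) \<le> 1"
proof (cases "w = p 0")
  case True
  then show ?thesis using gdist_edge[OF edge_sym[OF assms(4)]] by (intro bexI[of _ 0]) auto
next
  case False
  then have "(p 0, w) \<in> E" using assms gdist_le_1[of "p 0" w] window_V[OF win, of 0] by auto
  then show ?thesis using no_branch[of p w z] assms unfolding branch_def by force
qed

end

section \<open>Volume growth and energy\<close>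

context lfc_graph
begin

text \<open>With \<open>g = \<eta>\<^sup>2 / f\<close>, each term on the left is
  \<open>(\<eta> x - \<eta> y)\<^sup>2 - (g y - g x) * (f y - f x)\<close>. The subtracted part sums
  to 0 because \<open>f\<close> is harmonic and \<open>F\<close> contains all neighbours of points
  where \<open>\<eta>\<close> is nonzero.\<close>

lemma harmonic_energy:
  assumes har: "harmonic V E f" and pos: "\<And>x. x \<in> V \<Longrightarrow> 0 < f x"
    and F: "finite F" "F \<subseteq> V" and supp: "\<And>x. x \<in> F \<Longrightarrow> \<eta> x \<noteq> 0 \<Longrightarrow> E `` {x} \<subseteq> F"
  shows "(\<Sum>(x, y)\<in>E \<inter> F \<times> F. f x * f y * (\<eta> x / f x - \<eta> y / f y)\<^sup>2)
       = (\<Sum>(x, y)\<in>E \<inter> F \<times> F. (\<eta> x - \<eta> y)\<^sup>2)"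
proof -
  define P where "P = E \<inter> F \<times> F"
  define g where "g = (\<lambda>x. (\<eta> x)\<^sup>2 / f x)"
  have "(\<Sum>(x, y)\<in>P. g x * (f y - f x)) = (\<Sum>x\<in>F. \<Sum>y\<in>E `` {x} \<inter> F. g x * (f y - f x))"
    using F finite_nbrs by (subst sum.Sigma) (auto simp: P_def intro!: sum.cong)
  also have "\<dots> = (\<Sum>x\<in>F. 0)"
  proof (rule sum.cong[OF refl])
    fix x assume x: "x \<in> F"
    show "(\<Sum>y\<in>E `` {x} \<inter> F. g x * (f y - f x)) = 0"
    proof (cases "\<eta> x = 0")
      case False
      then have "E `` {x} \<inter> F = E `` {x}" using supp x by blast
      moreover have "laplacian E f x = 0" using har x F by (auto simp: harmonic_def)
      ultimately show ?thesis by (simp add: laplacian_def flip: sum_distrib_left)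
    qed (simp add: g_def)
  qed
  finally have out: "(\<Sum>(x, y)\<in>P. g x * (f y - f x)) = 0" by simp
  \<comment> \<open>Every edge occurs as two ordered pairs; exchanging them reduces this sum to the
    previous one.\<close>
  have swap: "(\<Sum>(x, y)\<in>P. g y * (f y - f x)) = (\<Sum>(x, y)\<in>P. g x * (f x - f y))"
    by (rule sum.reindex_bij_witness[of _ prod.swap prod.swap]) (auto simp: P_def edge_sym)
  also have "\<dots> = - (\<Sum>(x, y)\<in>P. g x * (f y - f x))"
    by (simp add: case_prod_beta right_diff_distrib sum_subtractf)
  finally have into: "(\<Sum>(x, y)\<in>P. g y * (f y - f x)) = 0" using out by simp
  have "(\<Sum>(x, y)\<in>P. f x * f y * (\<eta> x / f x - \<eta> y / f y)\<^sup>2)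
      = (\<Sum>(x, y)\<in>P. (\<eta> x - \<eta> y)\<^sup>2 - (g y * (f y - f x) - g x * (f y - f x)))"
  proof (rule sum.cong[OF refl])
    fix e assume "e \<in> P"
    then obtain x y where e: "e = (x, y)" "0 < f x" "0 < f y"
      using pos F by (auto simp: P_def)
    then show "(case e of (x, y) \<Rightarrow> f x * f y * (\<eta> x / f x - \<eta> y / f y)\<^sup>2)
      = (case e of (x, y) \<Rightarrow> (\<eta> x - \<eta> y)\<^sup>2 - (g y * (f y - f x) - g x * (f y - f x)))"
      by (simp add: g_def field_simps power2_eq_square)
  qed
  also have "\<dots> = (\<Sum>(x, y)\<in>P. (\<eta> x - \<eta> y)\<^sup>2)"
    using out into by (simp add: case_prod_beta sum_subtractf)
  finally show ?thesis by (simp add: P_def)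
qed

definition gball :: "'a \<Rightarrow> nat \<Rightarrow> 'a set" where
  "gball x n = {y \<in> V. d x y \<le> n}"

end

section \<open>From tubes to linear volume growth\<close>

context nonneg_curved_graph
begin

text \<open>A closed neighbourhood has at most 4 points. This crude bound supplies finiteness and
  the size of balls of bounded radius.\<close>

lemma gball_card:
  assumes "x \<in> V"
  shows "finite (gball x n) \<and> card (gball x n) \<le> 4 ^ n"
proof (induction n)
  case 0
  have "gball x 0 = {x}" using assms gdist_eq_0 by (auto simp: gball_def)
  then show ?case by simp
next
  case (Suc n)
  have sub: "gball x (Suc n) \<subseteq> (\<Union>y\<in>gball x n. star y)"
  proof
    fix z assume "z \<in> gball x (Suc n)"
    then have z: "z \<in> V" "d x z \<le> Suc n" by (auto simp: gball_def)
    \<comment> \<open>The minimum also covers \<open>d x z \<le> n\<close>, where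
      \<open>y = z\<close>.\<close>
    obtain y where y: "y \<in> V" "d x y = min n (d x z)" "d y z = d x z - min n (d x z)"
      using gdist_split[of x z "min n (d x z)"] assms z by auto
    then have "y = z \<or> (y, z) \<in> E" using z gdist_le_1[of y z] by auto
    then show "z \<in> (\<Union>y\<in>gball x n. star y)" using y by (auto simp: gball_def)
  qed
  have "card (star y) \<le> 4" if "y \<in> gball x n" for y
    using that degree_le_3[of y] finite_nbrs
    by (auto simp: gball_def degree_def card_insert_if)
  then have "(\<Sum>y\<in>gball x n. card (star y)) \<le> (\<Sum>y\<in>gball x n. 4)" by (rule sum_mono)
  moreover have "card (\<Union>y\<in>gball x n. star y) \<le> (\<Sum>y\<in>gball x n. card (star y))"
    using Suc by (intro card_UN_le) auto
  moreover have fin: "finite (\<Union>y\<in>gball x n. star y)" using Suc finite_nbrs by auto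
  ultimately show ?case
    using card_mono[OF fin sub] finite_subset[OF sub fin] Suc by auto
qed

definition geodesic :: "(nat \<Rightarrow> 'a) \<Rightarrow> nat \<Rightarrow> bool" where
  "geodesic p n \<longleftrightarrow> (\<forall>i<n. (p i, p (Suc i)) \<in> E) \<and> p 0 \<in> V \<and> d (p 0) (p n) = n"

lemma geodesic_V: "geodesic p n \<Longrightarrow> i \<le> n \<Longrightarrow> p i \<in> V"
  using geodesic_dist(1)[of n p i n] by (auto simp: geodesic_def)

lemma geodesic_gdist: "geodesic p n \<Longrightarrow> i \<le> j \<Longrightarrow> j \<le> n \<Longrightarrow> d (p i) (p j) = j - i"
  using geodesic_dist(2)[of n p i j] by (auto simp: geodesic_def)

lemma geodesic_window:
  assumes p: "geodesic p n" and "4 \<le> s" "s + 4 \<le> n"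
  shows "window (\<lambda>i. p (nat (int s + i)))"
  unfolding window_def
proof (intro ballI conjI)
  fix i j :: int assume ij: "i \<in> {-4..4}" "j \<in> {-4..4}"
  then have k: "nat (int s + i) \<le> n" "nat (int s + j) \<le> n" using assms by auto
  show V: "p (nat (int s + i)) \<in> V" using geodesic_V[OF p] k by blast
  show "int (d (p (nat (int s + i))) (p (nat (int s + j)))) = \<bar>i - j\<bar>"
  proof (cases "i \<le> j")
    case True
    then show ?thesis using geodesic_gdist[OF p, of "nat (int s + i)" "nat (int s + j)"] k ij assms
      by auto
  next
    case False
    then show ?thesis using geodesic_gdist[OF p, of "nat (int s + j)" "nat (int s + i)"] k ij assms
        gdist_sym[OF V geodesic_V[OF p k(2)]] by auto
  qed
qed

lemma geodesic_tube:
  assumes p: "geodesic p n" and s: "4 \<le> s" "s + 4 \<le> n"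
    and "d (p s) w \<le> 1" "w \<in> V" "(w, z) \<in> E"
  shows "\<exists>j\<le>n. d z (p j) \<le> 1"
proof -
  obtain i :: int where "i \<in> {-4..4}" "d z (p (nat (int s + i))) \<le> 1"
    using tube[OF geodesic_window[OF p s], of w z] assms by auto
  then show ?thesis using s by (intro exI[of _ "nat (int s + i)"]) auto
qed

text \<open>Once another geodesic from \<open>p 0\<close> meets \<open>p\<close> at distance 5, it cannot leave the tube around
  \<open>p\<close> except near the end point.\<close>

lemma geodesic_close:
  assumes p: "geodesic p n" and n: "9 \<le> n"
    and z: "z \<in> V" "d (p 0) z = n" "d (p 5) z = n - 5"
  shows "d z (p n) \<le> 10"
proof -
  have V: "p i \<in> V" if "i \<le> n" for i using geodesic_V[OF p that] .
  have d0: "d (p 0) (p i) = i" if "i \<le> n" for i using geodesic_gdist[OF p, of 0 i] that by simp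
  have level: "j \<le> t + 1" "t \<le> j + 1"
    if "j \<le> n" "x \<in> V" "d x (p j) \<le> 1" "d (p 0) x = t" for j t x
  proof -
    have "d (p 0) (p j) \<le> d (p 0) x + d x (p j)" "d (p 0) x \<le> d (p 0) (p j) + d (p j) x"
      using that V by (auto intro: gdist_triangle)
    then show "j \<le> t + 1" "t \<le> j + 1"
      using that d0[of j] gdist_sym[of x "p j"] V by auto
  qed
  \<comment> \<open>The upper bound goes through \<open>p 5\<close>, the lower bound through
    \<open>y\<close>.\<close>
  have inner: "d (p 0) x = t"
    if "x \<in> V" "y \<in> V" "d (p 5) x = t - 5" "d x y = k" "d (p 0) y = t + k" "5 \<le> t" for x y t k
    using gdist_triangle[of "p 0" x y] gdist_triangle[of "p 0" "p 5" x] that V[of 0] V[of 5] d0[of 5] n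
    by auto
  \<comment> \<open>The index \<open>j\<close> is within 1 of the level of the preceding vertex, and
    a window around \<open>p j\<close> needs \<open>4 \<le> j\<close> and
    \<open>j + 4 \<le> n\<close>; hence the levels run from 5 to \<open>n - 4\<close>.\<close>
  have tube: "\<exists>j\<le>n. d x (p j) \<le> 1"
    if "5 \<le> t" "t + 4 \<le> n" "x \<in> V" "d (p 0) x = t" "d (p 5) x = t - 5" for t x
    using that
  proof (induction t arbitrary: x rule: dec_induct)
    case base
    then have "x = p 5" using gdist_eq_0[of "p 5" x] V n by auto
    then show ?case using n by (intro exI[of _ 5]) auto
  next
    case (step t)
    have "d (p 5) x = t - 5 + 1" "x \<in> V" using step by auto
    then obtain w where w: "w \<in> V" "d (p 5) w = t - 5" "d w x = 1"
      using gdist_split[of "p 5" x "t - 5"] V[of 5] n by auto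
    have w0: "d (p 0) w = t" using inner[of w x t 1] w step by auto
    obtain j where j: "j \<le> n" "d w (p j) \<le> 1" using step.IH[OF _ w(1) w0 w(2)] step.prems by auto
    have "4 \<le> j" "j + 4 \<le> n" using level[OF j(1) w(1) j(2) w0] step by auto
    moreover have "(w, x) \<in> E" using w gdist_eq_1 step.prems by blast
    ultimately show ?case
      using geodesic_tube[OF p, of j w x] j w gdist_sym[of w "p j"] V by auto
  qed
  \<comment> \<open>Go back 4 steps from \<open>z\<close> to the last level the tube covers. The
    bound 10 is 4 to \<open>x\<close>, 1 to \<open>p j\<close>, and 5 along \<open>p\<close>, since
    \<open>n - 5 \<le> j\<close>.\<close>
  have "p 5 \<in> V" "n - 9 \<le> d (p 5) z" and d4: "d (p 5) z - (n - 9) = 4" using V z n by auto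
  then obtain x where x: "x \<in> V" "d (p 5) x = n - 9" "d x z = 4"
    using gdist_split[of "p 5" z "n - 9"] z(1) unfolding d4 by blast
  have x0: "d (p 0) x = n - 4" using inner[of x z "n - 4" 4] x z n by auto
  have "5 \<le> n - 4" "n - 4 + 4 \<le> n" "d (p 5) x = n - 4 - 5" using x n by auto
  then obtain j where j: "j \<le> n" "d x (p j) \<le> 1" using tube[of "n - 4" x] x(1) x0 by blast
  have "n - 5 \<le> j" using level[OF j(1) x(1) j(2) x0] by auto
  then have "d (p j) (p n) \<le> 5" using geodesic_gdist[OF p, of j n] j by auto
  moreover have "d z (p n) \<le> d z x + d x (p n)" "d x (p n) \<le> d x (p j) + d (p j) (p n)"
    using V x z j by (auto intro: gdist_triangle)
  ultimately show ?thesis using j x gdist_sym[of x z] z by auto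
qed

lemma geodesic_through:
  assumes "x \<in> V" "y \<in> V" "z \<in> V" "d x z = d x y + d y z"
  obtains p where "geodesic p (d x z)" "p 0 = x" "p (d x y) = y" "p (d x z) = z"
proof -
  define m k where "m = d x y" and "k = d y z"
  obtain g where g: "g 0 = x" "g m = y" "\<forall>i<m. (g i, g (Suc i)) \<in> E"
    using relpow_gdist[OF assms(1,2)] by (auto simp: relpow_fun_conv m_def)
  obtain h where h: "h 0 = y" "h k = z" "\<forall>i<k. (h i, h (Suc i)) \<in> E"
    using relpow_gdist[OF assms(2,3)] by (auto simp: relpow_fun_conv k_def)
  define p where "p = (\<lambda>i. if i < m then g i else h (i - m))"
  have "(p i, p (Suc i)) \<in> E" if "i < m + k" for i
  proof (cases "i < m")
    case True
    then have "p (Suc i) = g (Suc i)"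
      using g h by (cases "Suc i = m") (auto simp: p_def)
    then show ?thesis using g(3) True by (simp add: p_def)
  next
    case False
    then show ?thesis using h(3)[rule_format, of "i - m"] that by (simp add: p_def Suc_diff_le)
  qed
  moreover have "p 0 = x" "p m = y" "p (m + k) = z"
    using g h by (auto simp: p_def)
  ultimately show ?thesis
    using that[of p] assms by (auto simp: geodesic_def m_def k_def)
qed

text \<open>The sphere is sorted by a vertex \<open>y\<close> at distance 5 on a geodesic from
  \<open>r\<close>. There are at most \<open>4 ^ 5\<close> choices of \<open>y\<close>, and each
  class lies in a ball of radius 10. Small spheres are covered by the crude bound.\<close>

lemma sphere_card:
  assumes rV: "r \<in> V"
  shows "card {z \<in> V. d r z = n} \<le> 4 ^ 15"
proof (cases "9 \<le> n")
  case False
  have "card {z \<in> V. d r z = n} \<le> card (gball r n)"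
    using gball_card[OF rV, of n] by (intro card_mono) (auto simp: gball_def)
  also have "\<dots> \<le> 4 ^ n" using gball_card[OF rV] by simp
  also have "\<dots> \<le> 4 ^ 15" using False by (intro power_increasing) auto
  finally show ?thesis .
next
  case True
  define T where "T = (\<lambda>y. {z \<in> V. d r z = n \<and> d r y = 5 \<and> d y z = n - 5})"
  have T: "finite (T y) \<and> card (T y) \<le> 4 ^ 10" if y: "y \<in> gball r 5" for y
  proof (cases "T y = {}")
    case False
    then obtain z where z: "z \<in> V" "d r z = n" "d r y = 5" "d y z = n - 5" by (auto simp: T_def)
    have yV: "y \<in> V" using y by (simp add: gball_def)
    obtain p where p: "geodesic p n" "p 0 = r" "p 5 = y" "p n = z"
      using geodesic_through[OF rV yV z(1)] z True by auto
    have sub: "T y \<subseteq> gball z 10"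
      using geodesic_close[OF p(1) True] p z gdist_sym[of z] by (auto simp: T_def gball_def)
    show ?thesis
      using gball_card[OF z(1), of 10] card_mono[OF _ sub] finite_subset[OF sub] by auto
  qed simp
  have sub: "{z \<in> V. d r z = n} \<subseteq> (\<Union>y\<in>gball r 5. T y)"
  proof
    fix z assume "z \<in> {z \<in> V. d r z = n}"
    then show "z \<in> (\<Union>y\<in>gball r 5. T y)"
      using gdist_split[of r z 5] rV True by (force simp: T_def gball_def)
  qed
  have fin: "finite (gball r 5)" "card (gball r 5) \<le> 4 ^ 5" using gball_card[OF rV, of 5] by auto
  have "card {z \<in> V. d r z = n} \<le> card (\<Union>y\<in>gball r 5. T y)"
    using sub fin T by (intro card_mono) auto
  also have "\<dots> \<le> (\<Sum>y\<in>gball r 5. card (T y))" by (rule card_UN_le[OF fin(1)])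
  also have "\<dots> \<le> (\<Sum>y\<in>gball r 5. 4 ^ 10)" using T by (intro sum_mono) auto
  also have "\<dots> \<le> 4 ^ 5 * 4 ^ 10" using fin by simp
  finally show ?thesis by simp
qed

lemma gball_linear_growth:
  assumes rV: "r \<in> V"
  shows "card (gball r n) \<le> (n + 1) * 4 ^ 15"
proof -
  have "gball r n = (\<Union>k\<in>{..n}. {z \<in> V. d r z = k})" by (auto simp: gball_def)
  then have "card (gball r n) \<le> (\<Sum>k\<in>{..n}. card {z \<in> V. d r z = k})"
    by (simp add: card_UN_le)
  also have "\<dots> \<le> (\<Sum>k\<in>{..n}. 4 ^ 15)" using sphere_card[OF rV] by (intro sum_mono) auto
  finally show ?thesis by simp
qed

text \<open>A linear cutoff at scale \<open>n\<close> has slope \<open>1 / n\<close> on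
  \<open>O(n)\<close> edges, hence energy \<open>O(1/n)\<close>. By \<open>harmonic_energy\<close>
  this bounds the single term of the edge \<open>(a, b)\<close>, which tends to a multiple of
  \<open>(1 / f a - 1 / f b)\<^sup>2\<close>.\<close>

lemma harmonic_edge:
  assumes har: "harmonic V E f" and pos: "\<And>x. x \<in> V \<Longrightarrow> 0 < f x" and e: "(a, b) \<in> E"
  shows "f a = f b"
proof -
  have V: "a \<in> V" "b \<in> V" using e edge_V by auto
  \<comment> \<open>The degree bound times the bound on spheres.\<close>
  define C :: real where "C = 3 * 4 ^ 15"
  have bound: "f a * f b * (1 / f a - (1 - 1 / real n) / f b)\<^sup>2 \<le> C * (1 / real n + (1 / real n)\<^sup>2)"
    if n: "1 \<le> n" for n
  proof -
    define F where "F = gball a n"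
    define P where "P = E \<inter> F \<times> F"
    define \<eta> where "\<eta> = (\<lambda>x. max 0 (1 - real (d a x) / real n))"
    have F: "finite F" "F \<subseteq> V" using gball_card[OF V(1)] by (auto simp: F_def gball_def)
    have nbr: "d a y \<le> d a x + 1" if "(x, y) \<in> E" for x y
      using gdist_triangle[of a x y] gdist_edge[OF that] edge_V[OF that] V by auto
    \<comment> \<open>At distance \<open>n\<close> the cutoff is already 0, so its support lies
      strictly inside the ball.\<close>
    have supp: "E `` {x} \<subseteq> F" if "x \<in> F" "\<eta> x \<noteq> 0" for x
    proof -
      have "d a x < n"
        using that n by (auto simp: \<eta>_def max_def field_simps split: if_splits)
      then show ?thesis using nbr edge_V by (force simp: F_def gball_def)
    qed
    have "P \<subseteq> (SIGMA x:F. E `` {x})" by (auto simp: P_def)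
    then have "card P \<le> card (SIGMA x:F. E `` {x})"
      using F finite_nbrs by (intro card_mono) auto
    also have "\<dots> = (\<Sum>x\<in>F. card (E `` {x}))" using F finite_nbrs by simp
    also have "\<dots> \<le> (\<Sum>x\<in>F. 3)"
      using degree_le_3 F by (intro sum_mono) (auto simp: degree_def)
    also have "\<dots> \<le> 3 * ((n + 1) * 4 ^ 15)"
      using gball_linear_growth[OF V(1), of n] by (simp add: F_def)
    finally have "real (card P) \<le> real (3 * ((n + 1) * 4 ^ 15))" by (rule of_nat_mono)
    then have cardP: "real (card P) \<le> C * (real n + 1)" by (simp add: C_def algebra_simps)
    have step: "(\<eta> x - \<eta> y)\<^sup>2 \<le> (1 / real n)\<^sup>2" if "(x, y) \<in> P" for x y
    proof -
      have "\<bar>real (d a x) / real n - real (d a y) / real n\<bar> \<le> 1 / real n"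
        using nbr[of x y] nbr[of y x] that edge_sym[of x y] n
        by (auto simp: P_def simp flip: diff_divide_distrib intro!: divide_right_mono)
      then have "\<bar>\<eta> x - \<eta> y\<bar> \<le> \<bar>1 / real n\<bar>" by (auto simp: \<eta>_def max_def)
      then show ?thesis by (simp only: abs_le_square_iff)
    qed
    have "\<eta> a = 1" "\<eta> b = 1 - 1 / real n" using gdist_edge[OF e] n by (auto simp: \<eta>_def)
    then have "f a * f b * (1 / f a - (1 - 1 / real n) / f b)\<^sup>2
        = (case (a, b) of (x, y) \<Rightarrow> f x * f y * (\<eta> x / f x - \<eta> y / f y)\<^sup>2)" by simp
    \<comment> \<open>All terms are nonnegative, so one of them is at most the sum.\<close>
    also have "\<dots> \<le> (\<Sum>(x, y)\<in>P. f x * f y * (\<eta> x / f x - \<eta> y / f y)\<^sup>2)"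
    proof (rule member_le_sum)
      show "(a, b) \<in> P" using e V n gdist_edge[OF e] by (auto simp: P_def F_def gball_def)
      show "finite P" using F by (auto simp: P_def)
    next
      fix e assume "e \<in> P - {(a, b)}"
      moreover have "0 \<le> f x" if "x \<in> F" for x
        using that F pos less_imp_le by blast
      ultimately show "0 \<le> (case e of (x, y) \<Rightarrow> f x * f y * (\<eta> x / f x - \<eta> y / f y)\<^sup>2)"
        by (auto simp: P_def)
    qed
    also have "\<dots> = (\<Sum>(x, y)\<in>P. (\<eta> x - \<eta> y)\<^sup>2)"
      unfolding P_def by (rule harmonic_energy[OF har pos F supp])
    also have "\<dots> \<le> (\<Sum>e\<in>P. (1 / real n)\<^sup>2)" using step by (intro sum_mono) auto
    also have "\<dots> \<le> C * (real n + 1) * (1 / real n)\<^sup>2"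
      using cardP by (simp add: mult_right_mono del: power_divide times_divide_eq_right)
    also have "\<dots> = C * (1 / real n + (1 / real n)\<^sup>2)"
      using n by (simp add: field_simps power2_eq_square)
    finally show ?thesis .
  qed
  have lim: "(\<lambda>n. 1 / real n) \<longlonglongrightarrow> 0" by (rule lim_1_over_n)
  have "(\<lambda>n. f a * f b * (1 / f a - (1 - 1 / real n) / f b)\<^sup>2)
          \<longlonglongrightarrow> f a * f b * (1 / f a - (1 - 0) / f b)\<^sup>2"
    using pos V by (intro tendsto_intros lim) force
  moreover have "(\<lambda>n. C * (1 / real n + (1 / real n)\<^sup>2)) \<longlonglongrightarrow> C * (0 + 0\<^sup>2)"
    by (intro tendsto_intros lim)
  ultimately have "f a * f b * (1 / f a - (1 - 0) / f b)\<^sup>2 \<le> C * (0 + 0\<^sup>2)"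
    using bound by (intro LIMSEQ_le) auto
  moreover have "0 < f a" "0 < f b" using pos V by auto
  ultimately have "(1 / f a - 1 / f b)\<^sup>2 \<le> 0" by (simp add: mult_le_0_iff)
  then show ?thesis by simp
qed

lemma positive_harmonic_constant:
  assumes "harmonic V E f" "\<And>x. x \<in> V \<Longrightarrow> 0 < f x"
  shows "\<exists>c. \<forall>u\<in>V. f u = c"
proof -
  have "f u = f v" if "(u, v) \<in> E\<^sup>*" for u v
    using that by induction (use harmonic_edge[OF assms] in auto)
  then show ?thesis
    using lfc unfolding locally_finite_connected_graph_def by metis
qed

end

theorem theorem5p1:
  fixes V :: "'a set" and E :: "'a rel" and f :: "'a \<Rightarrow> real"
  assumes "class_G V E" and "infinite V"
    and "harmonic V E f" and "\<forall>u\<in>V. f u > 0"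
  shows "\<exists>c. \<forall>u\<in>V. f u = c"
proof -
  interpret nonneg_curved_graph V E
    using assms(1) by unfold_locales (auto simp: class_G_def)
  show ?thesis using positive_harmonic_constant assms by blast
qed

end
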